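(* Let $f(x)\in\mathbb{Z}[x]$ have degree $d\ge2$ and let $t\in\mathbb{Z}$ be a wandering point for $f$. Let $k\ge1$ be an integer. Then every $(S(f,t),k)$-inclusion-exclusion fraction is $(f,t,k)$-accessible.
   Context: $\operatorname{Orb}_f(t)=\{f^n(t):n\ge0\}$ ($f^0(x)=x$, $f^n=f\circ f^{n-1}$); $t$ is wandering if this set is infinite. For an integer sequence $(a_n)_{n\ge1}$, an integer $u\ge2$ is a primitive divisor of $a_m$ if $u\mid a_m$ and $u\nmid a_s$ for all $1\le s<m$. Let $S(f,t)=\{n\ge1: f^n(t)-t \text{ has a primitive divisor}\}$, where primitive divisors refer to the sequence $(f^n(t)-t)_{n\ge1}$. For $S\subseteq\mathbb{Z}_{>0}$, a nonnegative rational number $\delta<1$ is an $(S,k)$-inclusion-exclusion fraction if there are $n_1,\dots,n_k\in S$ with $$\delta=\sum_{j=1}^k(-1)^{j+1}\sum_{1\le i_1<\dots<i_j\le k}\frac{1}{\operatorname{lcm}(n_{i_1},\dots,n_{i_j})}.$$ For $A\subseteq\mathbb{Z}$, $$\delta_{f,t}(A)=\lim_{X\to\infty}\frac{|\{x\in A\cap \operatorname{Orb}_f(t): x\le X\}|}{|\{x\in\operatorname{Orb}_f(t): x\le X\}|},$$ provided this limit exists. A real number $\delta\in[0,1]$ is $(f,t,k)$-accessible if there is a system of arithmetic progressions $\{t+n_s\mathbb{Z}\}_{s=1}^k$ with positive integers $n_s$ such that $\delta_{f,t}\left(\bigcup_{s=1}^k(t+n_s\mathbb{Z})\right)=\delt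a$.
   Formalization: The density counts orbit points with |x| ≤ X instead of x ≤ X, because for orbits with infinitely many negative points (e.g. f = -x²-1, t = 0) the counts x ≤ X are infinite and the quotient is undefined; when those counts are finite, both densities agree. *)

theory Defs
  imports Complex_Main "HOL-Computational_Algebra.Polynomial"
begin

definition orbit :: "int poly \<Rightarrow> int \<Rightarrow> int set" where
  "orbit f t = {(poly f ^^ n) t | n. True}"

definition wandering :: "int poly \<Rightarrow> int \<Rightarrow> bool" where
  "wandering f t \<longleftrightarrow> infinite (orbit f t)"

text \<open>Sequences are indexed from 1; the value at index 0 is never inspected.\<close>

definition primitive_divisor :: "(nat \<Rightarrow> int) \<Rightarrow> nat \<Rightarrow> int \<Rightarrow> bool" where
  "primitive_divisor a m u \<longleftrightarrow>
     u \<ge> 2 \<and> u dvd a m \<and> (\<forall>s. 1 \<le> s \<and> s < m \<longrightarrow> \<not> u dvd a s)"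

definition prim_div_indices :: "int poly \<Rightarrow> int \<Rightarrow> nat set" where
  "prim_div_indices f t =
     {n. n \<ge> 1 \<and> (\<exists>u. primitive_divisor (\<lambda>m. (poly f ^^ m) t - t) n u)}"

text \<open>The tuples \<open>i\<^sub>1 < \<dots> < i\<^sub>j\<close> in \<open>{1..k}\<close> are represented by the
  \<open>j\<close>-element subsets \<open>I\<close> of \<open>{1..k}\<close>; the \<open>n\<^sub>i\<close> need not be distinct.\<close>

definition incl_excl_fraction :: "nat set \<Rightarrow> nat \<Rightarrow> rat \<Rightarrow> bool" where
  "incl_excl_fraction S k \<delta> \<longleftrightarrow>
     0 \<le> \<delta> \<and> \<delta> < 1 \<and>
     (\<exists>n :: nat \<Rightarrow> nat. (\<forall>i\<in>{1..k}. n i \<in> S) \<and>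
        \<delta> = (\<Sum>j=1..k. (-1) ^ (j + 1) *
               (\<Sum>I | I \<subseteq> {1..k} \<and> card I = j. 1 / of_nat (LCM i\<in>I. n i))))"

text \<open>Orbit points are counted by absolute value. Counting the points \<open>x \<le> X\<close> gives
  infinite sets, hence no meaningful quotient, when infinitely many orbit points are
  negative (e.g. for a negative leading coefficient). Whenever the sets of points
  \<open>x \<le> X\<close> are finite, the two counts agree for all large \<open>X\<close> and define the same density;
  see \<open>has_orbit_density_iff_one_sided\<close> below.\<close>

definition has_orbit_density :: "int poly \<Rightarrow> int \<Rightarrow> int set \<Rightarrow> real \<Rightarrow> bool" where
  "has_orbit_density f t A \<delta> \<longleftrightarrow>
     ((\<lambda>X :: real. real (card {x \<in> A \<inter> orbit f t. real_of_int \<bar>x\<bar> \<le> X}) /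
                   real (card {x \<in> orbit f t. real_of_int \<bar>x\<bar> \<le> X})) \<longlongrightarrow> \<delta>) at_top"

lemma has_orbit_density_iff_one_sided:
  assumes fin: "\<And>X :: real. finite {x \<in> orbit f t. real_of_int x \<le> X}"
  shows "has_orbit_density f t A \<delta> \<longleftrightarrow>
     ((\<lambda>X :: real. real (card {x \<in> A \<inter> orbit f t. real_of_int x \<le> X}) /
                   real (card {x \<in> orbit f t. real_of_int x \<le> X})) \<longlongrightarrow> \<delta>) at_top"
proof -
  define N where "N = (\<lambda>x. real_of_int \<bar>x\<bar>) ` {x \<in> orbit f t. real_of_int x \<le> 0}"
  have "finite N"
    unfolding N_def using fin[of 0] by (rule finite_imageI)
  then obtain M where M: "\<And>y. y \<in> N \<Longrightarrow> y \<le> M"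
    using bdd_above_finite bdd_above.unfold by metis
  have abs_iff: "real_of_int \<bar>x\<bar> \<le> X \<longleftrightarrow> real_of_int x \<le> X"
    if X: "X \<ge> M" and x: "x \<in> orbit f t" for X x
  proof (cases "x \<le> 0")
    case True
    then have "real_of_int \<bar>x\<bar> \<in> N"
      unfolding N_def using x by auto
    then have "real_of_int \<bar>x\<bar> \<le> X"
      using M X by fastforce
    then show ?thesis by linarith
  qed auto
  have sets_eq: "{x \<in> A \<inter> orbit f t. real_of_int \<bar>x\<bar> \<le> X} = {x \<in> A \<inter> orbit f t. real_of_int x \<le> X}"
    "{x \<in> orbit f t. real_of_int \<bar>x\<bar> \<le> X} = {x \<in> orbit f t. real_of_int x \<le> X}"
    if "X \<ge> M" for X
    using abs_iff[OF that] by blast+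
  show ?thesis
    unfolding has_orbit_density_def
    by (rule filterlim_cong[OF refl refl])
       (use eventually_ge_at_top[of M] in eventually_elim, simp only: sets_eq)
qed

definition accessible :: "int poly \<Rightarrow> int \<Rightarrow> nat \<Rightarrow> real \<Rightarrow> bool" where
  "accessible f t k \<delta> \<longleftrightarrow>
     0 \<le> \<delta> \<and> \<delta> \<le> 1 \<and>
     (\<exists>n :: nat \<Rightarrow> int. (\<forall>s\<in>{1..k}. n s > 0) \<and>
        has_orbit_density f t (\<Union>s\<in>{1..k}. {t + n s * z | z. True}) \<delta>)"

end

theory Submission imports Defs begin

text \<open>If \<open>u\<close> is a primitive divisor of \<open>f\<^sup>n(t) - t\<close>, then modulo \<open>u\<close> the point \<open>t\<close> is periodic
  with exact period \<open>n\<close>, so \<open>f\<^sup>m(t)\<close> lies in \<open>t + u\<int>\<close> iff \<open>n\<close> divides \<open>m\<close>. Choosing a primitive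
  divisor for each of the given \<open>n\<^sub>1, \<dots>, n\<^sub>k\<close> yields progressions whose union meets the orbit
  exactly at the times divisible by some \<open>n\<^sub>i\<close>. By inclusion-exclusion these times have the desired
  density. As the degree is at least 2, the orbit points eventually grow strictly in absolute value,
  so the orbit density equals the density of the times.\<close>

section \<open>Divisibility along the orbit\<close>

lemma diff_dvd_poly_diff:
  fixes p :: "'a :: comm_ring_1 poly"
  shows "x - y dvd poly p x - poly p y"
proof (induction p)
  case (pCons a p)
  have "poly (pCons a p) x - poly (pCons a p) y = x * (poly p x - poly p y) + (x - y) * poly p y"
    by (simp add: algebra_simps)
  then show ?case
    using pCons by (metis dvd_add dvd_mult dvd_triv_left)
qed simp

lemma dvd_poly_funpow_diff:
  fixes f :: "int poly"
  assumes "u dvd x - y"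
  shows "u dvd (poly f ^^ m) x - (poly f ^^ m) y"
proof (induction m)
  case (Suc m)
  have "(poly f ^^ m) x - (poly f ^^ m) y dvd poly f ((poly f ^^ m) x) - poly f ((poly f ^^ m) y)"
    by (rule diff_dvd_poly_diff)
  with Suc show ?case
    using dvd_trans by auto
qed (use assms in simp)

text \<open>Modulo \<open>u\<close>, the iterates at times \<open>m\<close> and \<open>m - n\<close>
  agree, so strong induction brings \<open>m\<close> below \<open>n\<close>. There primitivity of
  \<open>u\<close> excludes every positive time, and time 0 satisfies both sides.\<close>

lemma primitive_divisor_dvd_orbit_iff:
  fixes f :: "int poly"
  assumes "n \<ge> 1" and u: "primitive_divisor (\<lambda>m. (poly f ^^ m) t - t) n u"
  shows "u dvd (poly f ^^ m) t - t \<longleftrightarrow> n dvd m"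
proof (induction m rule: less_induct)
  case (less m)
  consider "m = 0" | "0 < m" "m < n" | "n \<le> m"
    by linarith
  then show ?case
  proof cases
    case 2
    then show ?thesis
      using u unfolding primitive_divisor_def by (auto dest: dvd_imp_le)
  next
    case 3
    have "(poly f ^^ m) t = (poly f ^^ (m - n)) ((poly f ^^ n) t)"
      using 3 by (metis comp_apply funpow_add le_add_diff_inverse2)
    moreover have "u dvd (poly f ^^ n) t - t"
      using u unfolding primitive_divisor_def by blast
    ultimately have "u dvd (poly f ^^ m) t - (poly f ^^ (m - n)) t"
      using dvd_poly_funpow_diff by metis
    then have "u dvd (poly f ^^ m) t - t \<longleftrightarrow> u dvd (poly f ^^ (m - n)) t - t"
      using dvd_add_right_iff[of u "(poly f ^^ m) t - (poly f ^^ (m - n)) t"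
          "(poly f ^^ (m - n)) t - t"] by simp
    also have "\<dots> \<longleftrightarrow> n dvd m - n"
      using less[of "m - n"] 3 assms(1) by simp
    also have "\<dots> \<longleftrightarrow> n dvd m"
      using 3 by (simp add: dvd_minus_self)
    finally show ?thesis .
  qed simp
qed

section \<open>Growth of the orbit\<close>

lemma abs_poly_gt_abs_eventually:
  fixes f :: "int poly"
  assumes "degree f \<ge> 2"
  obtains B where "\<And>x. \<bar>x\<bar> \<ge> B \<Longrightarrow> \<bar>poly f x\<bar> > \<bar>x\<bar>"
proof -
  obtain a q where f: "f = pCons a q"
    by (cases f)
  obtain b r where q: "q = pCons b r"
    by (cases q)
  have "r \<noteq> 0"
    using assms unfolding f q by (auto split: if_splits)
  then have "finite (abs ` {x. poly r x = 0})"
    by (intro finite_imageI poly_roots_finite)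
  then have "bdd_above (abs ` {x. poly r x = 0})"
    by (rule bdd_above_finite)
  then obtain C where C: "\<And>x. poly r x = 0 \<Longrightarrow> \<bar>x\<bar> \<le> C"
    unfolding bdd_above_def by blast
  show thesis
  \<comment> \<open>Here \<open>f\<close> is a + x(b + x r(x)). The bound \<open>C + 1\<close> puts
    x beyond all roots of \<open>r\<close>, where the integer r(x) has absolute value at least 1.
    The other bound absorbs \<open>b\<close>, leaving |q(x)| \<ge> 2, and then \<open>a\<close>,
    since 2|x| - |a| > |x|.\<close>
  proof (rule that[of "max (C + 1) (\<bar>a\<bar> + \<bar>b\<bar> + 2)"])
    fix x :: int assume x: "\<bar>x\<bar> \<ge> max (C + 1) (\<bar>a\<bar> + \<bar>b\<bar> + 2)"
    then have "poly r x \<noteq> 0"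
      using C[of x] by auto
    then have "\<bar>x * poly r x\<bar> \<ge> \<bar>x\<bar>"
      using mult_left_mono[of 1 "\<bar>poly r x\<bar>" "\<bar>x\<bar>"] by (simp add: abs_mult)
    then have "\<bar>poly q x\<bar> \<ge> 2"
      unfolding q using x by (simp only: poly_pCons max.bounded_iff) linarith
    then have "\<bar>x * poly q x\<bar> \<ge> 2 * \<bar>x\<bar>"
      using mult_left_mono[of 2 "\<bar>poly q x\<bar>" "\<bar>x\<bar>"] by (simp add: abs_mult)
    then show "\<bar>poly f x\<bar> > \<bar>x\<bar>"
      unfolding f using x by (simp only: poly_pCons max.bounded_iff) linarith
  qed
qed

text \<open>If the values at times i < j coincide, any time m \<ge> j can be replaced by the smaller
  time m - j + i. The orbit would then consist of its first \<open>j\<close> points and be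
  finite.\<close>

lemma wandering_inj:
  assumes "wandering f t"
  shows "inj (\<lambda>m. (poly f ^^ m) t)"
proof (rule ccontr)
  assume "\<not> ?thesis"
  then obtain i j where "i < j" and eq: "(poly f ^^ i) t = (poly f ^^ j) t"
    unfolding inj_def by (metis linorder_neqE_nat)
  have "(poly f ^^ m) t \<in> (\<lambda>m. (poly f ^^ m) t) ` {..<j}" for m
  proof (induction m rule: less_induct)
    case (less m)
    show ?case
    proof (cases "m < j")
      case False
      then have "(poly f ^^ m) t = (poly f ^^ (m - j)) ((poly f ^^ j) t)"
        by (metis comp_apply funpow_add le_add_diff_inverse2 not_less)
      also have "\<dots> = (poly f ^^ (m - j + i)) t"
        by (simp add: eq[symmetric] funpow_add)
      finally show ?thesis
        using less[of "m - j + i"] \<open>i < j\<close> False by simp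
    qed simp
  qed
  then have "orbit f t \<subseteq> (\<lambda>m. (poly f ^^ m) t) ` {..<j}"
    unfolding orbit_def by blast
  then show False
    using assms finite_subset unfolding wandering_def by blast
qed

text \<open>An infinite orbit must leave the finite interval \<open>{-B..B}\<close>. From then on
  every application of \<open>f\<close> increases the absolute value, so the orbit stays in the
  region of growth.\<close>

lemma orbit_abs_eventually_strict_mono:
  assumes "degree f \<ge> 2" and "wandering f t"
  obtains M where "\<And>m m'. M \<le> m \<Longrightarrow> m < m' \<Longrightarrow> \<bar>(poly f ^^ m) t\<bar> < \<bar>(poly f ^^ m') t\<bar>"
proof -
  obtain B where B: "\<And>x. \<bar>x\<bar> \<ge> B \<Longrightarrow> \<bar>poly f x\<bar> > \<bar>x\<bar>"
    using abs_poly_gt_abs_eventually[OF assms(1)] by metis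
  have "\<not> orbit f t \<subseteq> {-B..B}"
    using assms(2) finite_subset[of "orbit f t" "{-B..B}"] unfolding wandering_def by blast
  then obtain M where "(poly f ^^ M) t \<notin> {-B..B}"
    unfolding orbit_def by blast
  then have M: "\<bar>(poly f ^^ M) t\<bar> \<ge> B"
    by auto
  have ge: "\<bar>(poly f ^^ m) t\<bar> \<ge> B" if "M \<le> m" for m
    using that
  proof (induction m rule: dec_induct)
    case (step m)
    then show ?case
      using B[of "(poly f ^^ m) t"] by simp
  qed (rule M)
  show thesis
  proof (rule that)
    fix m m' assume "M \<le> m" "m < m'"
    from \<open>m < m'\<close> show "\<bar>(poly f ^^ m) t\<bar> < \<bar>(poly f ^^ m') t\<bar>"
    proof (induction m')
      case (Suc m')
      then have "\<bar>(poly f ^^ m') t\<bar> < \<bar>(poly f ^^ Suc m') t\<bar>"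
        using B[OF ge[of m']] \<open>M \<le> m\<close> by simp
      with Suc show ?case
        by (cases "m = m'") auto
    qed simp
  qed
qed

section \<open>From densities of times to densities of orbit points\<close>

lemma has_orbit_density_of_index_density:
  assumes "degree f \<ge> 2" and "wandering f t"
    and lim: "(\<lambda>N. real (card {m. m < N \<and> (poly f ^^ m) t \<in> A}) / real N) \<longlonglongrightarrow> \<delta>"
  shows "has_orbit_density f t A \<delta>"
proof -
  define x where "x = (\<lambda>m. (poly f ^^ m) t)"
  define N where "N = (\<lambda>X::real. card {m. real_of_int \<bar>x m\<bar> \<le> X})"
  have inj: "inj x"
    unfolding x_def by (rule wandering_inj) fact
  have orbit: "orbit f t = range x"
    unfolding orbit_def x_def by auto
  obtain M where M: "\<And>m m'. M \<le> m \<Longrightarrow> m < m' \<Longrightarrow> \<bar>x m\<bar> < \<bar>x m'\<bar>"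
    using orbit_abs_eventually_strict_mono[OF assms(1,2)] unfolding x_def by metis
  have fin: "finite {m. real_of_int \<bar>x m\<bar> \<le> X}" for X
  proof (rule finite_subset)
    show "{m. real_of_int \<bar>x m\<bar> \<le> X} \<subseteq> x -` {-\<lceil>X\<rceil>..\<lceil>X\<rceil>}"
      by (auto; linarith)
    show "finite (x -` {-\<lceil>X\<rceil>..\<lceil>X\<rceil>})"
      using inj by (intro finite_vimageI) auto
  qed
  \<comment> \<open>For X \<ge> \<open>C M\<close>, the initial stretch, where growth may fail, is
    counted in full. For X \<ge> \<open>C K\<close>, at least K + 1 times are counted, which makes
    \<open>N\<close> tend to infinity.\<close>
  define C where "C = (\<lambda>K. Max ((\<lambda>m. real_of_int \<bar>x m\<bar>) ` {..K}))"
  have C: "real_of_int \<bar>x m\<bar> \<le> C K" if "m \<le> K" for m K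
    unfolding C_def using that by (intro Max_ge) auto
  have segment: "{m. real_of_int \<bar>x m\<bar> \<le> X} = {..<N X}" if X: "X \<ge> C M" for X
  proof -
    let ?S = "{m. real_of_int \<bar>x m\<bar> \<le> X}"
    have down: "m' \<in> ?S" if "m \<in> ?S" "m' < m" for m m'
    proof (cases "m' \<le> M")
      case True
      then show ?thesis
        using C[of m' M] X by auto
    next
      case False
      then show ?thesis
        using M[of m' m] that by auto
    qed
    \<comment> \<open>\<open>?S\<close> is downward closed, so each member \<open>m\<close> brings
      along m + 1 members and lies below the cardinality. Equal cardinalities then turn the
      inclusion into equality.\<close>
    have "?S \<subseteq> {..<card ?S}"
    proof
      fix m assume m: "m \<in> ?S"
      then have "{..m} \<subseteq> ?S"
        using down le_neq_implies_less by blast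
      then have "card {..m} \<le> card ?S"
        using fin card_mono by blast
      then show "m \<in> {..<card ?S}"
        by simp
    qed
    then show ?thesis
      unfolding N_def using card_subset_eq[of "{..<card ?S}" ?S] by simp
  qed
  have "filterlim N at_top at_top"
    unfolding filterlim_at_top
  proof
    fix K
    show "\<forall>\<^sub>F X in at_top. K \<le> N X"
      using eventually_ge_at_top[of "C K"]
    proof eventually_elim
      case (elim X)
      then have "{..K} \<subseteq> {m. real_of_int \<bar>x m\<bar> \<le> X}"
        using C by fastforce
      then have "card {..K} \<le> N X"
        unfolding N_def using fin card_mono by blast
      then show ?case
        by simp
    qed
  qed
  from filterlim_compose[OF lim this]
  have "((\<lambda>X. real (card {m. m < N X \<and> x m \<in> A}) / real (N X)) \<longlongrightarrow> \<delta>) at_top"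
    unfolding x_def .
  \<comment> \<open>For X \<ge> \<open>C M\<close> the orbit quotient at X is the time quotient at
    \<open>N X\<close>, since the injective \<open>x\<close> preserves cardinalities.\<close>
  then show ?thesis
    unfolding has_orbit_density_def
  proof (rule Lim_transform_eventually)
    show "\<forall>\<^sub>F X in at_top. real (card {m. m < N X \<and> x m \<in> A}) / real (N X) =
        real (card {y \<in> A \<inter> orbit f t. real_of_int \<bar>y\<bar> \<le> X}) /
        real (card {y \<in> orbit f t. real_of_int \<bar>y\<bar> \<le> X})"
      using eventually_ge_at_top[of "C M"]
    proof eventually_elim
      case (elim X)
      have iff: "real_of_int \<bar>x m\<bar> \<le> X \<longleftrightarrow> m < N X" for m
        using segment[OF elim] by blast
      have "{y \<in> A \<inter> orbit f t. real_of_int \<bar>y\<bar> \<le> X} = x ` {m. m < N X \<and> x m \<in> A}"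
        "{y \<in> orbit f t. real_of_int \<bar>y\<bar> \<le> X} = x ` {..<N X}"
        using iff unfolding orbit by auto
      then show ?case
        using card_image[OF inj_on_subset[OF inj subset_UNIV]] by simp
    qed
  qed
qed

section \<open>Densities of sets of multiples\<close>

text \<open>Time 0 counts as a multiple, so the count is N/L rounded up, which lies between N/L and
  N/L + 1.\<close>

lemma multiples_density:
  fixes L :: nat
  assumes "L > 0"
  shows "(\<lambda>N. real (card {m. m < N \<and> L dvd m}) / real N) \<longlonglongrightarrow> 1 / real L"
proof -
  have card: "card {m. m < N \<and> L dvd m} = (N + L - 1) div L" for N
  proof -
    have iff: "L * i < N \<longleftrightarrow> i < (N + L - 1) div L" for i
    proof -
      have "i < (N + L - 1) div L \<longleftrightarrow> Suc i * L \<le> N + L - 1"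
        using assms by (simp add: Suc_le_eq[symmetric] less_eq_div_iff_mult_less_eq)
      then show ?thesis
        using assms by (auto simp: algebra_simps)
    qed
    have "{m. m < N \<and> L dvd m} = (*) L ` {i. L * i < N}"
      by (auto elim: dvdE)
    also have "{i. L * i < N} = {..<(N + L - 1) div L}"
      unfolding iff by blast
    finally have "{m. m < N \<and> L dvd m} = (*) L ` {..<(N + L - 1) div L}" .
    then show ?thesis
      using assms by (simp add: card_image inj_on_def)
  qed
  have bounds: "1 / real L \<le> real (card {m. m < N \<and> L dvd m}) / real N \<and>
      real (card {m. m < N \<and> L dvd m}) / real N \<le> 1 / real L + 1 / real N" if "N > 0" for N
  proof -
    define c where "c = (N + L - 1) div L"
    have "c * L + (N + L - 1) mod L = N + L - 1" "(N + L - 1) mod L < L"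
      unfolding c_def using assms by simp_all
    then have "N \<le> c * L" "c * L \<le> N + L"
      using that by linarith+
    then have "real N \<le> real c * real L" "real c * real L \<le> real N + real L"
      by (metis of_nat_le_iff of_nat_mult, metis of_nat_add of_nat_le_iff of_nat_mult)
    then show ?thesis
      unfolding card c_def[symmetric] using that assms by (simp add: field_simps)
  qed
  have "(\<lambda>N. 1 / real L + 1 / real N) \<longlonglongrightarrow> 1 / real L + 0"
    by (intro tendsto_add tendsto_const lim_1_over_n)
  then have upper: "(\<lambda>N. 1 / real L + 1 / real N) \<longlonglongrightarrow> 1 / real L"
    by simp
  show ?thesis
  proof (rule tendsto_sandwich[OF _ _ tendsto_const upper])
    show "\<forall>\<^sub>F N in sequentially. 1 / real L \<le> real (card {m. m < N \<and> L dvd m}) / real N"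
      using eventually_gt_at_top[of 0] by eventually_elim (use bounds in blast)
    show "\<forall>\<^sub>F N in sequentially.
        real (card {m. m < N \<and> L dvd m}) / real N \<le> 1 / real L + 1 / real N"
      using eventually_gt_at_top[of 0] by eventually_elim (use bounds in blast)
  qed
qed

text \<open>Inclusion-exclusion is exact for each \<open>N\<close>, and the limit is taken termwise
  in a finite sum.\<close>

lemma union_multiples_density:
  fixes n :: "'i \<Rightarrow> nat"
  assumes "finite J" and pos: "\<And>i. i \<in> J \<Longrightarrow> n i > 0"
  shows "(\<lambda>N. real (card {m. m < N \<and> (\<exists>i\<in>J. n i dvd m)}) / real N) \<longlonglongrightarrow>
    (\<Sum>I | I \<subseteq> J \<and> I \<noteq> {}. (-1) ^ (card I + 1) * (1 / real (LCM i\<in>I. n i)))"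
proof -
  interpret Incl_Excl finite "\<lambda>S :: nat set. real (card S)"
    by unfold_locales (auto simp: card_Un_disjnt)
  have count: "real (card {m. m < N \<and> (\<exists>i\<in>J. n i dvd m)}) =
    (\<Sum>I | I \<subseteq> J \<and> I \<noteq> {}. (-1) ^ (card I + 1) * real (card {m. m < N \<and> (LCM i\<in>I. n i) dvd m}))"
    (is "_ = ?R") for N
  proof -
    have "{m. m < N \<and> (\<exists>i\<in>J. n i dvd m)} = (\<Union>i\<in>J. {m. m < N \<and> n i dvd m})"
      by auto
    then have "real (card {m. m < N \<and> (\<exists>i\<in>J. n i dvd m)}) = (\<Sum>I | I \<subseteq> J \<and> I \<noteq> {}.
        (-1) ^ (card I + 1) * real (card (\<Inter>i\<in>I. {m. m < N \<and> n i dvd m})))"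
      using restricted_indexed[OF assms(1), of "\<lambda>i. {m. m < N \<and> n i dvd m}"] by simp
    also have "\<dots> = ?R"
    proof (rule sum.cong[OF refl])
      \<comment> \<open>Nonemptiness of \<open>I\<close> keeps the condition m < N in the
        intersection.\<close>
      fix I assume "I \<in> {I. I \<subseteq> J \<and> I \<noteq> {}}"
      then have "(\<Inter>i\<in>I. {m. m < N \<and> n i dvd m}) = {m. m < N \<and> (LCM i\<in>I. n i) dvd m}"
        by (auto simp: Lcm_dvd_iff)
      then show "(-1) ^ (card I + 1) * real (card (\<Inter>i\<in>I. {m. m < N \<and> n i dvd m})) =
          (-1) ^ (card I + 1) * real (card {m. m < N \<and> (LCM i\<in>I. n i) dvd m})"
        by (rule arg_cong)
    qed
    finally show ?thesis .
  qed
  have "(\<lambda>N. \<Sum>I | I \<subseteq> J \<and> I \<noteq> {}. (-1) ^ (card I + 1) *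
      (real (card {m. m < N \<and> (LCM i\<in>I. n i) dvd m}) / real N)) \<longlonglongrightarrow>
    (\<Sum>I | I \<subseteq> J \<and> I \<noteq> {}. (-1) ^ (card I + 1) * (1 / real (LCM i\<in>I. n i)))"
  proof (intro tendsto_sum tendsto_mult tendsto_const multiples_density)
    fix I assume "I \<in> {I. I \<subseteq> J \<and> I \<noteq> {}}"
    then have "finite (n ` I)" "0 \<notin> n ` I"
      using assms(1) pos finite_subset by fastforce+
    then show "(LCM i\<in>I. n i) > 0"
      using Lcm_0_iff_nat by blast
  qed
  then show ?thesis
    unfolding count sum_divide_distrib by simp
qed

text \<open>Links the sum grouped by size, as in \<open>incl_excl_fraction\<close>, to the sum over
  nonempty subsets that inclusion-exclusion yields.\<close>

lemma sum_by_card: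
  fixes g :: "'i set \<Rightarrow> 'a :: ring_1"
  assumes "finite J"
  shows "(\<Sum>j=1..card J. (-1) ^ (j + 1) * (\<Sum>I | I \<subseteq> J \<and> card I = j. g I)) =
    (\<Sum>I | I \<subseteq> J \<and> I \<noteq> {}. (-1) ^ (card I + 1) * g I)"
proof -
  let ?S = "{I. I \<subseteq> J \<and> I \<noteq> {}}"
  have fin: "finite ?S"
    using assms by simp
  have "card ` ?S \<subseteq> {1..card J}"
    using assms by (auto simp: card_mono Suc_le_eq card_gt_0_iff finite_subset)
  then have "(\<Sum>I\<in>?S. (-1) ^ (card I + 1) * g I) =
      (\<Sum>j=1..card J. \<Sum>I | I \<in> ?S \<and> card I = j. (-1) ^ (card I + 1) * g I)"
    by (intro sum.group[symmetric] fin) auto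
  also have "\<dots> = (\<Sum>j=1..card J. (-1) ^ (j + 1) * (\<Sum>I | I \<subseteq> J \<and> card I = j. g I))"
    unfolding sum_distrib_left by (intro sum.cong) auto
  finally show ?thesis ..
qed

section \<open>Progressions with primitive divisors as moduli\<close>

theorem theorem6p3:
  fixes f :: "int poly" and t :: int and k :: nat and \<delta> :: rat
  assumes "degree f \<ge> 2"
    and "wandering f t"
    and "k \<ge> 1"
    and "incl_excl_fraction (prim_div_indices f t) k \<delta>"
  shows "accessible f t k (of_rat \<delta>)"
proof -
  obtain n where \<delta>: "0 \<le> \<delta>" "\<delta> < 1"
    and n: "\<And>i. i \<in> {1..k} \<Longrightarrow> n i \<in> prim_div_indices f t"
    and \<delta>_eq: "\<delta> = (\<Sum>j=1..k. (-1) ^ (j + 1) *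
      (\<Sum>I | I \<subseteq> {1..k} \<and> card I = j. 1 / of_nat (LCM i\<in>I. n i)))"
    using assms(4) unfolding incl_excl_fraction_def by blast
  have "\<exists>u. primitive_divisor (\<lambda>m. (poly f ^^ m) t - t) (n i) u" if "i \<in> {1..k}" for i
    using n[OF that] unfolding prim_div_indices_def by blast
  then obtain u where
    u: "\<And>i. i \<in> {1..k} \<Longrightarrow> primitive_divisor (\<lambda>m. (poly f ^^ m) t - t) (n i) (u i)"
    by metis
  have pos: "n i \<ge> 1" if "i \<in> {1..k}" for i
    using n[OF that] unfolding prim_div_indices_def by blast
  \<comment> \<open>The moduli are the divisors \<open>u i\<close>, not the \<open>n i\<close>: the
    orbit meets t + (u i)Z exactly at the times divisible by \<open>n i\<close>.\<close>
  define A where "A = (\<Union>i\<in>{1..k}. {t + u i * z | z. True})"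
  have "(poly f ^^ m) t \<in> A \<longleftrightarrow> (\<exists>i\<in>{1..k}. n i dvd m)" for m
  proof -
    have "(poly f ^^ m) t \<in> A \<longleftrightarrow> (\<exists>i\<in>{1..k}. u i dvd (poly f ^^ m) t - t)"
      unfolding A_def dvd_def by (auto simp: algebra_simps)
    then show ?thesis
      using primitive_divisor_dvd_orbit_iff[OF pos u] by blast
  qed
  moreover have "of_rat \<delta> = (\<Sum>I | I \<subseteq> {1..k} \<and> I \<noteq> {}. (-1) ^ (card I + 1) * (1 / real (LCM i\<in>I. n i)))"
    using sum_by_card[of "{1..k}" "\<lambda>I. 1 / rat_of_nat (LCM i\<in>I. n i)"]
    unfolding \<delta>_eq by (simp add: of_rat_sum of_rat_mult of_rat_power of_rat_divide of_rat_minus)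
  ultimately have "(\<lambda>N. real (card {m. m < N \<and> (poly f ^^ m) t \<in> A}) / real N) \<longlonglongrightarrow> of_rat \<delta>"
    using union_multiples_density[of "{1..k}" n] pos by (simp add: Suc_le_eq)
  then have "has_orbit_density f t A (of_rat \<delta>)"
    using has_orbit_density_of_index_density assms(1,2) by blast
  moreover have "u i > 0" if "i \<in> {1..k}" for i
    using u[OF that] unfolding primitive_divisor_def by simp
  ultimately show ?thesis
    using \<delta> unfolding accessible_def A_def by (intro conjI exI[of _ u]) auto
qed

end
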